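(* Let $(x(t),y(t))_{t\ge t_0}$ be a global solution of the dynamical system $$\begin{cases}\ddot{x}(t)+\frac{\alpha}{t^q}\dot{x}(t)+\beta(t)\left(\nabla_{x}\mathcal{L}\left(x(t),y(t)+\frac{t^q}{\alpha-1}\dot{y}(t)\right)+\frac{c}{t^p}x(t)\right)=0,\\ \ddot{y}(t)+\frac{\alpha}{t^q}\dot{y}(t)-\beta(t)\left(\nabla_y \mathcal{L}\left(x(t)+\frac{t^q}{\alpha-1}\dot{x}(t),y(t)\right)-\frac{c}{t^p}y(t)\right)=0.\end{cases}$$ Suppose that there exists $M>0$ such that $$\frac{\dot\beta(t)}{\beta(t)}\le \frac{\alpha-1}{t^q}-\frac{M}{t}\quad\text{for all } t\ge t_0,$$ and that $$\int_{t_0}^{+\infty} t^{-q-p}\beta(t)\,dt<+\infty.$$ Then, for any $(x^*,y^* )\in\Omega$, $$\mathcal{L}(x(t),y^* )-\mathcal{L}(x^*,y(t))=o\left(\frac{1}{\beta(t)}\right)\quad\text{as } t\to+\infty,$$ $$\lim_{t\to+\infty}\left\|\frac{\alpha-1}{t^q}(x(t)-x^* )+\dot x(t)\right\|^2=0,$$ and $$\lim_{t\to+\infty}\left\|\frac{\alpha-1}{t^q}(y(t)-y^* )+\dot y(t)\right\|^2=0.$$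
   Context: $f:\mathbb{R}^n\to\mathbb{R}$ and $g:\mathbb{R}^m\to\mathbb{R}$ are continuously differentiable convex functions, $K:\mathbb{R}^n\to\mathbb{R}^m$ is a (continuous) linear operator, and $\mathcal{L}(x,y)=f(x)+\langle Kx,y\rangle-g(y)$ for $(x,y)\in\mathbb{R}^n\times\mathbb{R}^m$; the saddle point problem is $\min_{x}\max_{y}\mathcal{L}(x,y)$. $\nabla_x\mathcal{L}$ and $\nabla_y\mathcal{L}$ are the partial gradients, so $\nabla_x\mathcal{L}(x,y)=\nabla f(x)+K^*y$ and $\nabla_y\mathcal{L}(x,y)=Kx-\nabla g(y)$, where $K^*$ is the adjoint of $K$. $\Omega$ is the set of saddle points of $\mathcal{L}$, i.e. of pairs $(x^*,y^* )$ with $\mathcal{L}(x^*,y)\le\mathcal{L}(x^*,y^* )\le\mathcal{L}(x,y^* )$ for all $(x,y)\in\mathbb{R}^n\times\mathbb{R}^m$; it is assumed that $\Omega\ne\emptyset$. Norms are Euclidean. Standing parameters: $t_0>0$, $\alpha>1$, $0<q<1$, $p>0$, $c>0$, and $\beta:[t_0,+\infty)\to(0,+\infty)$ is continuously differentiable and nondecreasing. A global solution is a twice differentiable trajectory satisfying the system for all $t\ge t_0$. *)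

theory Defs
  imports "HOL-Analysis.Analysis" "HOL-Library.Landau_Symbols"
begin

text \<open>The value is meaningful only at points where \<open>f\<close> is differentiable.\<close>

definition gradient :: "('a::real_inner \<Rightarrow> real) \<Rightarrow> 'a \<Rightarrow> 'a" where
  "gradient f x = (THE D. GDERIV f x :> D)"

definition continuously_differentiable :: "('a::real_inner \<Rightarrow> real) \<Rightarrow> bool" where
  "continuously_differentiable f \<longleftrightarrow>
     (\<forall>x. f differentiable (at x)) \<and> continuous_on UNIV (gradient f)"

definition lagrangian ::
  "('a \<Rightarrow> real) \<Rightarrow> ('b::real_inner \<Rightarrow> real) \<Rightarrow> ('a \<Rightarrow> 'b) \<Rightarrow> 'a \<Rightarrow> 'b \<Rightarrow> real" where
  "lagrangian f g K x y = f x + K x \<bullet> y - g y"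

definition grad_x :: "('a::real_inner \<Rightarrow> 'b \<Rightarrow> real) \<Rightarrow> 'a \<Rightarrow> 'b \<Rightarrow> 'a" where
  "grad_x L x y = gradient (\<lambda>u. L u y) x"

definition grad_y :: "('a \<Rightarrow> 'b::real_inner \<Rightarrow> real) \<Rightarrow> 'a \<Rightarrow> 'b \<Rightarrow> 'b" where
  "grad_y L x y = gradient (\<lambda>v. L x v) y"

definition saddle_points :: "('a \<Rightarrow> 'b \<Rightarrow> real) \<Rightarrow> ('a \<times> 'b) set" where
  "saddle_points L = {(xs, ys). \<forall>x y. L xs y \<le> L xs ys \<and> L xs ys \<le> L x ys}"

text \<open>
  Trajectories live on \<open>[t0, \<infinity>)\<close>, so derivatives are taken within \<open>{t0..}\<close> (one-sided at \<open>t0\<close>)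
  and values at times before \<open>t0\<close> are irrelevant. The functions \<open>x'\<close>, \<open>x''\<close>, \<open>y'\<close>, \<open>y''\<close> are
  the first and second time derivatives; they are uniquely determined on \<open>{t0..}\<close>.
\<close>

definition global_solution ::
  "('a::real_inner \<Rightarrow> 'b::real_inner \<Rightarrow> real) \<Rightarrow> real \<Rightarrow> real \<Rightarrow> real \<Rightarrow> real \<Rightarrow> real \<Rightarrow> (real \<Rightarrow> real) \<Rightarrow>
   (real \<Rightarrow> 'a) \<Rightarrow> (real \<Rightarrow> 'a) \<Rightarrow> (real \<Rightarrow> 'a) \<Rightarrow> (real \<Rightarrow> 'b) \<Rightarrow> (real \<Rightarrow> 'b) \<Rightarrow> (real \<Rightarrow> 'b) \<Rightarrow> bool"
where
  "global_solution L t0 \<alpha> q p c \<beta> x x' x'' y y' y'' \<longleftrightarrow>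
     (\<forall>t\<ge>t0.
        (x has_vector_derivative x' t) (at t within {t0..}) \<and>
        (x' has_vector_derivative x'' t) (at t within {t0..}) \<and>
        (y has_vector_derivative y' t) (at t within {t0..}) \<and>
        (y' has_vector_derivative y'' t) (at t within {t0..}) \<and>
        x'' t + (\<alpha> / t powr q) *\<^sub>R x' t
          + \<beta> t *\<^sub>R (grad_x L (x t) (y t + (t powr q / (\<alpha> - 1)) *\<^sub>R y' t)
                    + (c / t powr p) *\<^sub>R x t) = 0 \<and>
        y'' t + (\<alpha> / t powr q) *\<^sub>R y' t
          - \<beta> t *\<^sub>R (grad_y L (x t + (t powr q / (\<alpha> - 1)) *\<^sub>R x' t) (y t)
                    - (c / t powr p) *\<^sub>R y t) = 0)"

end

theory Submission imports Defs begin

text \<open>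
  Write \<open>A = \<alpha> - 1\<close> and let \<open>(xs, ys)\<close> be a saddle point. The anchored velocities
  \<open>w = (A / t^q) (x - xs) + x'\<close> and \<open>v = (A / t^q) (y - ys) + y'\<close> measure the trajectory against the
  saddle point, and the extrapolated arguments in the system are exactly
  \<open>y + (t^q / A) y' = ys + (t^q / A) v\<close> and \<open>x + (t^q / A) x' = xs + (t^q / A) w\<close>. Hence, when the two
  equations are tested with \<open>w\<close> and \<open>v\<close>, the bilinear coupling contributes the same term
  \<open>(t^q / A) (K w \<bullet> v)\<close> twice with opposite signs. What remains are the gradients, along the
  trajectory, of the convex functions \<open>u \<mapsto> L u ys\<close> and \<open>b \<mapsto> - L xs b\<close>; tested with \<open>w\<close> and \<open>v\<close>, they
  produce at least \<open>(A / t^q) \<Phi> + \<Phi>'\<close> for the duality gap \<open>\<Phi> t = L (x t) ys - L xs (y t) \<ge> 0\<close>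
  (lemma \<open>duality_gap_decay\<close>).

  The Lyapunov function is \<open>E = \<beta> \<Phi> + e\<^sub>x + e\<^sub>y\<close>, where the block energy \<open>e\<^sub>x\<close> consists of \<open>|w|^2 / 2\<close>,
  the Tikhonov energy \<open>c \<beta> t^-p |x|^2 / 2\<close> and a multiple of \<open>|x - xs|^2\<close> whose coefficient is chosen to
  cancel the indefinite products \<open>(x - xs) \<bullet> x'\<close> in the derivative. The gain
  \<open>(A / t^q) \<beta> \<Phi>\<close> from convexity outweighs \<open>\<beta>' \<Phi>\<close> by \<open>(M / t) \<beta> \<Phi>\<close> according to the growth condition
  on \<open>\<beta>\<close>, and likewise for the Tikhonov energy, up to the integrable error caused by the
  regularization pulling towards \<open>0\<close> instead of \<open>xs\<close>. Friction and the decrease of \<open>t^-q\<close> give a decay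
  of the same order for the other terms (lemma \<open>block_energy_decay\<close>).
  Altogether, with some \<open>\<delta> > 0\<close> and a constant \<open>C\<close>,
  \<open>E' \<le> - (\<delta> / t) E + C t^(- q - p) \<beta>\<close>. Since \<open>1 / t\<close> has infinite integral and the source term has a
  finite one, \<open>E\<close> tends to \<open>0\<close> (lemma \<open>damped_tendsto_zero\<close>), and \<open>E\<close> dominates all three quantities
  in question.
\<close>

section \<open>Damped differential inequalities\<close>

text \<open>
  Multiplying by the integrating factor \<open>s^\<delta>\<close> gives \<open>(s^\<delta> E)' \<le> s^\<delta> b \<le> t^\<delta> b\<close> for \<open>s \<le> t\<close>, so
  \<open>E t \<le> (T / t)^\<delta> E T\<close> plus the integral of \<open>b\<close> over \<open>[T, t]\<close>. The integral is small for large \<open>T\<close>,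
  and then the first term is small for large \<open>t\<close>.
\<close>

lemma damped_tendsto_zero:
  fixes E E' b :: "real \<Rightarrow> real"
  assumes "a > 0" and "\<delta> > 0"
    and E: "\<And>t. t > a \<Longrightarrow> (E has_real_derivative E' t) (at t)"
    and E': "\<And>t. t > a \<Longrightarrow> E' t \<le> - (\<delta> / t) * E t + b t"
    and E0: "\<And>t. t > a \<Longrightarrow> E t \<ge> 0"
    and b0: "\<And>t. t \<ge> a \<Longrightarrow> b t \<ge> 0"
    and b: "continuous_on {a..} b" "b integrable_on {a..}"
  shows "(E \<longlongrightarrow> 0) at_top"
proof -
  define B where "B = (\<lambda>t. integral {a..t} b)"
  have int: "b integrable_on {a..t}" for t
    using b(1) by (intro integrable_continuous_real) (auto intro: continuous_on_subset)
  have B: "(B has_real_derivative b t) (at t)" if "t > a" for t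
  proof -
    have "(B has_real_derivative b t) (at t within {a..t+1})"
      unfolding B_def using b(1) that
      by (intro integral_has_real_derivative) (auto intro: continuous_on_subset)
    moreover have "t \<in> interior {a..t+1}" using that by (simp add: interior_atLeastAtMost_real)
    ultimately show ?thesis by (metis at_within_interior)
  qed
  define S where "S = Sup (B ` {a..})"
  have bdd: "bdd_above (B ` {a..})"
  proof (rule bdd_aboveI2)
    fix t assume "t \<in> {a..}"
    show "B t \<le> integral {a..} b"
      unfolding B_def using b0 int b(2) by (intro integral_subset_le) auto
  qed
  show ?thesis
  proof (rule order_tendstoI)
    fix e :: real assume "e < 0"
    show "eventually (\<lambda>t. e < E t) at_top"
      using eventually_gt_at_top[of a] by eventually_elim (use E0 \<open>e < 0\<close> in fastforce)
  next
    fix e :: real assume "e > 0"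
    then have "S - e / 2 < S" by simp
    then obtain T0 where T0: "T0 \<ge> a" "S - e / 2 < B T0"
      unfolding S_def using less_cSUP_iff[OF _ bdd, of "Sup (B ` {a..}) - e / 2"] by auto
    define T where "T = T0 + 1"
    have T: "T > a" using T0 by (simp add: T_def)
    have "B T0 \<le> B T"
      unfolding B_def using b0 int T0 by (intro integral_subset_le) (auto simp: T_def)
    then have BT: "S - e / 2 < B T" using T0 by simp
    \<comment> \<open>The supremum \<open>S\<close> of the partial integrals bounds the integral over \<open>[T, t]\<close> by \<open>e / 2\<close>.\<close>
    have est: "E t \<le> T powr \<delta> * E T * t powr (- \<delta>) + e / 2" if t: "t \<ge> T" for t
    proof -
      have "t > 0" "T > 0" using t T assms(1) by auto
      let ?F = "\<lambda>s. s powr \<delta> * E s - t powr \<delta> * B s"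
      have "?F t \<le> ?F T"
      proof (rule DERIV_nonpos_imp_nonincreasing[OF t])
        fix s assume s: "T \<le> s" "s \<le> t"
        have "s > 0" "s > a" using s T assms(1) by auto
        let ?D = "\<delta> * s powr (\<delta> - 1) * E s + s powr \<delta> * E' s - t powr \<delta> * b s"
        have "(?F has_real_derivative ?D) (at s)"
          using \<open>s > 0\<close> \<open>s > a\<close> by (auto intro!: derivative_eq_intros E B simp: powr_diff field_simps)
        moreover have "?D \<le> 0"
        proof -
          have "s powr \<delta> * E' s \<le> s powr \<delta> * (- (\<delta> / s) * E s + b s)"
            using E'[OF \<open>s > a\<close>] by (intro mult_left_mono) auto
          moreover have "s powr (\<delta> - 1) = s powr \<delta> / s"
            using \<open>s > 0\<close> by (simp add: powr_diff)
          moreover have "s powr \<delta> * b s \<le> t powr \<delta> * b s"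
            using s \<open>s > 0\<close> \<open>s > a\<close> b0 assms(2) by (intro mult_right_mono powr_mono2) auto
          ultimately show ?thesis by (simp add: algebra_simps)
        qed
        ultimately show "\<exists>y. (?F has_real_derivative y) (at s) \<and> y \<le> 0" by blast
      qed
      then have "t powr \<delta> * E t \<le> T powr \<delta> * E T + t powr \<delta> * (B t - B T)"
        by (simp add: algebra_simps)
      also have "\<dots> \<le> T powr \<delta> * E T + t powr \<delta> * (e / 2)"
      proof -
        have "B t \<le> S" unfolding S_def using t T by (intro cSUP_upper bdd) auto
        then show ?thesis using BT by (intro add_left_mono mult_left_mono) auto
      qed
      finally show ?thesis using \<open>t > 0\<close> by (simp add: powr_minus field_simps)
    qed
    have "((\<lambda>t. T powr \<delta> * E T * t powr (- \<delta>) + e / 2) \<longlongrightarrow> T powr \<delta> * E T * 0 + e / 2) at_top"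
      using assms(2) by (intro tendsto_intros tendsto_neg_powr filterlim_ident) auto
    then have "eventually (\<lambda>t. T powr \<delta> * E T * t powr (- \<delta>) + e / 2 < e) at_top"
      by (rule order_tendstoD) (use \<open>e > 0\<close> in simp)
    with eventually_ge_at_top[of T] show "eventually (\<lambda>t. E t < e) at_top"
      by eventually_elim (use est in force)
  qed
qed

section \<open>Gradients\<close>

lemma gradient_eq: "GDERIV f x :> D \<Longrightarrow> gradient f x = D"
  unfolding gradient_def gderiv_def
proof (rule the_equality)
  fix D' assume "(f has_derivative (\<lambda>h. h \<bullet> D)) (at x)" "(f has_derivative (\<lambda>h. h \<bullet> D')) (at x)"
  then have "(\<lambda>h. h \<bullet> D') = (\<lambda>h. h \<bullet> D)" by (rule has_derivative_unique[rotated])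
  then show "D' = D" by (metis inner_commute vector_eq_ldot)
qed

text \<open>
  The Riesz representative of the derivative is the value of its adjoint at \<open>1\<close>.
\<close>

lemma GDERIV_gradient:
  fixes f :: "'a::euclidean_space \<Rightarrow> real"
  assumes "f differentiable (at x)"
  shows "GDERIV f x :> gradient f x"
proof -
  from assms obtain f' where f': "(f has_derivative f') (at x)" by (auto simp: differentiable_def)
  then have "linear f'" by (rule has_derivative_linear)
  then have "f' = (\<lambda>h. h \<bullet> adjoint f' 1)" by (simp add: adjoint_works fun_eq_iff)
  with f' have "GDERIV f x :> adjoint f' 1" unfolding gderiv_def by simp
  then show ?thesis using gradient_eq by metis
qed

lemma GDERIV_chain:
  assumes f: "GDERIV f (x t) :> D" and x: "(x has_vector_derivative x') (at t within S)"
  shows "((\<lambda>s. f (x s)) has_real_derivative D \<bullet> x') (at t within S)"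
proof -
  have "((\<lambda>s. f (x s)) has_derivative (\<lambda>h. (h *\<^sub>R x') \<bullet> D)) (at t within S)"
    using has_derivative_compose[OF x[unfolded has_vector_derivative_def] f[unfolded gderiv_def]] .
  then show ?thesis
    by (simp add: has_field_derivative_def inner_commute mult_commute_abs)
qed

text \<open>
  Restricting \<open>f\<close> to the line through \<open>x\<close> and \<open>z\<close> reduces this to the tangent inequality for convex
  functions of one real variable.
\<close>

lemma convex_above_gradient:
  assumes "convex_on UNIV f" and "GDERIV f x :> D"
  shows "f x - f z \<le> D \<bullet> (x - z)"
proof -
  let ?h = "\<lambda>s::real. f (x + s *\<^sub>R (z - x))"
  have "convex_on UNIV ?h"
    unfolding convex_on_def
  proof (intro conjI allI impI ballI)
    fix r s u v :: real assume uv: "u \<ge> 0" "v \<ge> 0" "u + v = 1"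
    have "x + (u *\<^sub>R r + v *\<^sub>R s) *\<^sub>R (z - x) = (u + v) *\<^sub>R x + (u *\<^sub>R r + v *\<^sub>R s) *\<^sub>R (z - x)"
      by (simp add: uv)
    also have "\<dots> = u *\<^sub>R (x + r *\<^sub>R (z - x)) + v *\<^sub>R (x + s *\<^sub>R (z - x))"
      by (simp add: algebra_simps)
    finally show "?h (u *\<^sub>R r + v *\<^sub>R s) \<le> u * ?h r + v * ?h s"
      using assms(1) uv unfolding convex_on_def by simp
  qed simp
  moreover have "(?h has_real_derivative D \<bullet> (z - x)) (at 0)"
    by (rule GDERIV_chain) (auto intro!: derivative_eq_intros simp: assms(2))
  ultimately have "?h 1 - ?h 0 \<ge> (D \<bullet> (z - x)) * (1 - 0)"
    by (intro convex_on_imp_above_tangent[where A = UNIV]) auto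
  then show ?thesis by (simp add: algebra_simps)
qed

lemma has_real_derivative_norm_square:
  assumes "(x has_vector_derivative x') (at t within S)"
  shows "((\<lambda>s. (norm (x s))\<^sup>2) has_real_derivative 2 * (x t \<bullet> x')) (at t within S)"
  using bounded_bilinear.has_vector_derivative[OF bounded_bilinear_inner assms assms]
  by (simp add: has_real_derivative_iff_has_vector_derivative power2_norm_eq_inner inner_commute)

section \<open>The energy of one variable\<close>

text \<open>
  The two equations of the system have the same form, apart from the forcing gradient, so the energy
  estimate is proved once, for a trajectory \<open>x\<close> with velocity \<open>v\<close> and anchor point \<open>z\<close>.
  The parameter \<open>A\<close> stands for \<open>\<alpha> - 1\<close>.
\<close>

definition anchored_velocity ::
  "real \<Rightarrow> real \<Rightarrow> 'a::real_inner \<Rightarrow> (real \<Rightarrow> 'a) \<Rightarrow> (real \<Rightarrow> 'a) \<Rightarrow> real \<Rightarrow> 'a" where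
  "anchored_velocity A q z x v t = (A / t powr q) *\<^sub>R (x t - z) + v t"

text \<open>
  With \<open>a = A t^-q\<close>, the coefficient of the squared distance is \<open>(t^-q a - a') / 2\<close>: the derivative of
  half the squared anchored velocity contains \<open>(a' - t^-q a) ((x - z) \<bullet> v)\<close>, which the derivative of
  this term cancels.
\<close>

definition block_energy ::
  "real \<Rightarrow> real \<Rightarrow> real \<Rightarrow> real \<Rightarrow> (real \<Rightarrow> real) \<Rightarrow> 'a::real_inner \<Rightarrow> (real \<Rightarrow> 'a) \<Rightarrow> (real \<Rightarrow> 'a) \<Rightarrow>
   real \<Rightarrow> real" where
  "block_energy A q p c \<beta> z x v t =
     (norm (anchored_velocity A q z x v t))\<^sup>2 / 2
     + A * ((t powr - q)\<^sup>2 + q * t powr - q / t) / 2 * (norm (x t - z))\<^sup>2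
     + c * \<beta> t * t powr - p / 2 * (norm (x t))\<^sup>2"

lemma block_energy_ge_half_velocity:
  assumes "A > 0" "q > 0" "c > 0" "t > 0" "\<beta> t > 0"
  shows "(norm (anchored_velocity A q z x v t))\<^sup>2 / 2 \<le> block_energy A q p c \<beta> z x v t"
  using assms unfolding block_energy_def by simp

lemma has_real_derivative_powr_neg:
  fixes s t :: real
  assumes "t > 0"
  shows "((\<lambda>t. t powr - s) has_real_derivative - s * t powr - s / t) (at t)"
  using assms by (auto intro!: derivative_eq_intros simp: powr_diff)

text \<open>
  After the cancellation the derivative contains only the squares \<open>|v|^2\<close>, \<open>|x - z|^2\<close> and \<open>|x|^2\<close>,
  besides the forcing \<open>G\<close> and a product \<open>x \<bullet> (x - z)\<close>. The squared anchored velocity is at most twice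
  \<open>(A t^-q)^2 |x - z|^2 + |v|^2\<close>, so it suffices to compare the coefficients of these squares with the energy:
  \<open>\<delta> / t \<le> t^-q\<close> serves the friction term, \<open>\<delta> \<le> q\<close> the decay of the powers of \<open>t\<close> that multiply the
  distance, and \<open>\<delta> \<le> M\<close> the Tikhonov term. The error term in \<open>|z|^2\<close> comes from \<open>x \<bullet> (x - z)\<close>, which is
  bounded below by \<open>(|x|^2 - |z|^2) / 2\<close> but need not be nonnegative.
\<close>

lemma block_energy_decay:
  fixes x v :: "real \<Rightarrow> 'a::real_inner"
  assumes pos: "A > 0" "q > 0" "p > 0" "c > 0" "t > 0" "\<beta> t > 0"
    and x: "(x has_vector_derivative v t) (at t)"
    and v: "(v has_vector_derivative acc) (at t)"
    and \<beta>: "(\<beta> has_real_derivative \<beta>') (at t)"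
    and growth: "\<beta>' \<le> (A * t powr - q - M / t) * \<beta> t"
    and ode: "acc + ((A + 1) * t powr - q) *\<^sub>R v t + \<beta> t *\<^sub>R (G + (c * t powr - p) *\<^sub>R x t) = 0"
    and \<delta>: "\<delta> > 0" "\<delta> \<le> q" "\<delta> \<le> M" "\<delta> / t \<le> t powr - q"
  obtains D where "(block_energy A q p c \<beta> z x v has_real_derivative D) (at t)"
    and "D \<le> - (\<delta> / t) * block_energy A q p c \<beta> z x v t
             - \<beta> t * (G \<bullet> anchored_velocity A q z x v t)
             + c * A / 2 * (norm z)\<^sup>2 * (t powr (- q - p) * \<beta> t)"
proof -
  \<comment> \<open>In terms of \<open>r\<close> and \<open>\<tau>\<close> all coefficients are polynomials; \<open>r\<close> has derivative \<open>- q r \<tau>\<close>.\<close>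
  define r where "r = t powr - q"
  define \<tau> where "\<tau> = 1 / t"
  define \<zeta> where "\<zeta> = c * \<beta> t * t powr - p"
  define \<zeta>' where "\<zeta>' = c * \<beta>' * t powr - p - p * \<zeta> * \<tau>"
  define u where "u = x t - z"
  define w where "w = anchored_velocity A q z x v t"
  define k where "k = A * (r\<^sup>2 + q * r * \<tau>)"
  define k' where "k' = - (A * q * r * \<tau> * (2 * r + (q + 1) * \<tau>))"
  define w' where "w' = (A * r) *\<^sub>R v t + (- (q * A * r * \<tau>)) *\<^sub>R u + acc"
  have pos': "r > 0" "\<tau> > 0" "\<zeta> > 0" "k > 0"
    using pos by (auto simp: r_def \<tau>_def \<zeta>_def k_def add_pos_pos)
  have w: "w = (A * r) *\<^sub>R u + v t"
    by (simp add: w_def anchored_velocity_def u_def r_def powr_minus divide_inverse)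
  have dr: "((\<lambda>t. t powr - q) has_real_derivative - (q * r * \<tau>)) (at t)"
    using has_real_derivative_powr_neg[OF \<open>t > 0\<close>, of q] by (simp add: r_def \<tau>_def)
  have dp: "((\<lambda>t. t powr - p) has_real_derivative - (p * t powr - p * \<tau>)) (at t)"
    using has_real_derivative_powr_neg[OF \<open>t > 0\<close>, of p] by (simp add: \<tau>_def)
  have du: "((\<lambda>t. x t - z) has_vector_derivative v t) (at t)"
    using x by (auto intro!: derivative_eq_intros)
  have "((\<lambda>t. (A * t powr - q) *\<^sub>R (x t - z) + v t) has_vector_derivative w') (at t)"
    unfolding w'_def u_def
    by (rule derivative_eq_intros DERIV_cmult dr du v refl)+ (simp add: r_def algebra_simps)
  moreover have "anchored_velocity A q z x v = (\<lambda>t. (A * t powr - q) *\<^sub>R (x t - z) + v t)"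
    by (simp add: anchored_velocity_def fun_eq_iff powr_minus divide_inverse)
  ultimately have dw: "(anchored_velocity A q z x v has_vector_derivative w') (at t)" by simp
  have dk: "((\<lambda>t. A * ((t powr - q)\<^sup>2 + q * t powr - q / t)) has_real_derivative k') (at t)"
    using \<open>t > 0\<close> unfolding k'_def
    by (auto intro!: derivative_eq_intros simp: r_def \<tau>_def powr_diff power2_eq_square field_simps)
  have d\<zeta>: "((\<lambda>t. c * \<beta> t * t powr - p) has_real_derivative \<zeta>') (at t)"
    unfolding \<zeta>'_def \<zeta>_def
    by (rule DERIV_cong[OF DERIV_mult[OF DERIV_cmult[OF \<beta>] dp]]) (simp add: algebra_simps)
  define D where "D = w \<bullet> w' + (k' / 2 * (norm u)\<^sup>2 + k * (u \<bullet> v t))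
    + (\<zeta>' / 2 * (norm (x t))\<^sup>2 + \<zeta> * (x t \<bullet> v t))"
  have "(block_energy A q p c \<beta> z x v has_real_derivative D) (at t)"
  proof -
    note dd = has_real_derivative_norm_square[OF dw] has_real_derivative_norm_square[OF du]
      has_real_derivative_norm_square[OF x]
    have "((\<lambda>t. (norm (anchored_velocity A q z x v t))\<^sup>2 / 2
       + A * ((t powr - q)\<^sup>2 + q * t powr - q / t) / 2 * (norm (x t - z))\<^sup>2
       + c * \<beta> t * t powr - p / 2 * (norm (x t))\<^sup>2) has_real_derivative D) (at t)"
      by (rule DERIV_cong[OF DERIV_add[OF DERIV_add[OF DERIV_cdivide[OF dd(1)]
            DERIV_mult[OF DERIV_cdivide[OF dk] dd(2)]] DERIV_mult[OF DERIV_cdivide[OF d\<zeta>] dd(3)]]])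
        (simp add: D_def w_def u_def k_def \<zeta>_def r_def \<tau>_def)
    then show ?thesis by (simp add: block_energy_def[abs_def])
  qed
  moreover have "D \<le> - (\<delta> / t) * block_energy A q p c \<beta> z x v t - \<beta> t * (G \<bullet> w)
             + c * A / 2 * (norm z)\<^sup>2 * (t powr (- q - p) * \<beta> t)"
  proof -
    have acc: "acc = - ((A + 1) * r) *\<^sub>R v t - \<beta> t *\<^sub>R G - \<zeta> *\<^sub>R x t"
      using ode by (simp add: \<zeta>_def r_def algebra_simps eq_neg_iff_add_eq_0)
    have w': "w' = - (q * A * r * \<tau>) *\<^sub>R u - r *\<^sub>R v t - \<beta> t *\<^sub>R G - \<zeta> *\<^sub>R x t"
      unfolding w'_def acc by (simp add: algebra_simps)
    \<comment> \<open>The products \<open>u \<bullet> v t\<close> and \<open>x t \<bullet> v t\<close> drop out.\<close>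
    have D: "D = (k' / 2 - q * A\<^sup>2 * r\<^sup>2 * \<tau>) * (u \<bullet> u) - r * (v t \<bullet> v t) - \<beta> t * (G \<bullet> w)
        + (\<zeta>' / 2 * (x t \<bullet> x t) - \<zeta> * A * r * (x t \<bullet> u))"
      unfolding D_def w' w k_def power2_norm_eq_inner
      by (simp add: inner_add_left inner_add_right inner_diff_right inner_commute
          power2_eq_square algebra_simps)
    have "(norm w)\<^sup>2 / 2 \<le> A\<^sup>2 * r\<^sup>2 * (u \<bullet> u) + v t \<bullet> v t"
    proof -
      have "0 \<le> ((A * r) *\<^sub>R u - v t) \<bullet> ((A * r) *\<^sub>R u - v t)" by simp
      then show ?thesis unfolding w power2_norm_eq_inner
        by (simp add: inner_add_left inner_add_right inner_diff_left inner_diff_right inner_commute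
            power2_eq_square algebra_simps)
    qed
    then have "(\<delta> * \<tau>) * ((norm w)\<^sup>2 / 2) \<le> (\<delta> * \<tau>) * (A\<^sup>2 * r\<^sup>2 * (u \<bullet> u) + v t \<bullet> v t)"
      using pos' \<delta> by (intro mult_left_mono) auto
    also have "\<dots> \<le> q * A\<^sup>2 * r\<^sup>2 * \<tau> * (u \<bullet> u) + r * (v t \<bullet> v t)"
    proof -
      have "\<delta> * (\<tau> * A\<^sup>2 * r\<^sup>2 * (u \<bullet> u)) \<le> q * (\<tau> * A\<^sup>2 * r\<^sup>2 * (u \<bullet> u))"
        using pos' \<delta> by (intro mult_right_mono) auto
      moreover have "\<delta> * \<tau> * (v t \<bullet> v t) \<le> r * (v t \<bullet> v t)"
        using \<delta>(4) by (intro mult_right_mono) (auto simp: r_def \<tau>_def)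
      ultimately show ?thesis by (simp add: algebra_simps)
    qed
    finally have 1: "\<delta> * \<tau> * ((norm w)\<^sup>2 / 2) \<le> q * A\<^sup>2 * r\<^sup>2 * \<tau> * (u \<bullet> u) + r * (v t \<bullet> v t)" .
    have 2: "\<delta> * \<tau> * (k / 2 * (u \<bullet> u)) \<le> - (k' / 2) * (u \<bullet> u)"
    proof -
      have "\<delta> * (\<tau> * k) \<le> q * (\<tau> * k)" using pos' \<delta> by (intro mult_right_mono) auto
      also have "\<dots> \<le> - k'"
        using pos pos' by (simp add: k_def k'_def power2_eq_square algebra_simps)
      finally show ?thesis using mult_right_mono[of "\<delta> * (\<tau> * k)" "- k'" "(u \<bullet> u) / 2"] by simp
    qed
    have 3: "\<zeta>' / 2 * (x t \<bullet> x t) - \<zeta> * A * r * (x t \<bullet> u)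
      \<le> - \<delta> * \<tau> * (\<zeta> / 2 * (x t \<bullet> x t)) + \<zeta> * A * r / 2 * (z \<bullet> z)"
    proof -
      have "x t \<bullet> u \<ge> (x t \<bullet> x t - z \<bullet> z) / 2"
        using inner_ge_zero[of u] unfolding u_def
        by (simp add: inner_diff_left inner_diff_right inner_commute)
      then have "\<zeta> * A * r * (x t \<bullet> u) \<ge> \<zeta> * A * r * ((x t \<bullet> x t - z \<bullet> z) / 2)"
        using pos pos' by (intro mult_left_mono) auto
      moreover have "\<zeta>' \<le> \<zeta> * A * r - \<delta> * \<tau> * \<zeta>"
      proof -
        have "(c * t powr - p) * \<beta>' \<le> (c * t powr - p) * ((A * r - M * \<tau>) * \<beta> t)"
          using growth pos by (intro mult_left_mono) (auto simp: r_def \<tau>_def)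
        moreover have "\<delta> * (\<tau> * \<zeta>) \<le> M * (\<tau> * \<zeta>)" "0 \<le> p * \<zeta> * \<tau>"
          using \<delta> pos pos' by (auto intro!: mult_right_mono)
        ultimately show ?thesis unfolding \<zeta>'_def by (simp add: \<zeta>_def algebra_simps)
      qed
      then have "\<zeta>' / 2 * (x t \<bullet> x t) \<le> (\<zeta> * A * r - \<delta> * \<tau> * \<zeta>) / 2 * (x t \<bullet> x t)"
        by (intro mult_right_mono) auto
      ultimately show ?thesis by (simp add: algebra_simps)
    qed
    have "block_energy A q p c \<beta> z x v t = (norm w)\<^sup>2 / 2 + k / 2 * (u \<bullet> u) + \<zeta> / 2 * (x t \<bullet> x t)"
      by (simp add: block_energy_def w_def k_def u_def \<zeta>_def r_def \<tau>_def power2_norm_eq_inner)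
    then have "(\<delta> / t) * block_energy A q p c \<beta> z x v t = \<delta> * \<tau> * ((norm w)\<^sup>2 / 2)
        + \<delta> * \<tau> * (k / 2 * (u \<bullet> u)) + \<delta> * \<tau> * (\<zeta> / 2 * (x t \<bullet> x t))"
      by (simp add: \<tau>_def algebra_simps)
    moreover have "c * A / 2 * (norm z)\<^sup>2 * (t powr (- q - p) * \<beta> t) = \<zeta> * A * r / 2 * (z \<bullet> z)"
      using powr_add[of t "- q" "- p"] by (simp add: \<zeta>_def r_def power2_norm_eq_inner)
    ultimately show ?thesis
      unfolding D left_diff_distrib using 1 2 3 by linarith
  qed
  ultimately show ?thesis using that unfolding w_def by blast
qed


section \<open>The Lagrangian and its duality gap\<close>

lemma grad_x_lagrangian:
  fixes f :: "'a::euclidean_space \<Rightarrow> real" and g :: "'b::euclidean_space \<Rightarrow> real"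
  assumes "linear K" and "f differentiable (at x)"
  shows "grad_x (lagrangian f g K) x y = gradient f x + adjoint K y"
proof -
  have "((\<lambda>u. f u + u \<bullet> adjoint K y - g y) has_derivative (\<lambda>h. h \<bullet> (gradient f x + adjoint K y))) (at x)"
    using GDERIV_gradient[OF assms(2)] unfolding gderiv_def
    by (auto intro!: derivative_eq_intros simp: inner_add_right)
  then show ?thesis
    unfolding grad_x_def lagrangian_def
    by (intro gradient_eq) (simp add: gderiv_def adjoint_works[OF assms(1)])
qed

lemma grad_y_lagrangian:
  fixes g :: "'b::euclidean_space \<Rightarrow> real"
  assumes "g differentiable (at y)"
  shows "grad_y (lagrangian f g K) x y = K x - gradient g y"
  unfolding grad_y_def lagrangian_def
proof (rule gradient_eq)
  show "GDERIV (\<lambda>v. f x + K x \<bullet> v - g v) y :> K x - gradient g y"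
    using GDERIV_gradient[OF assms] unfolding gderiv_def
    by (auto intro!: derivative_eq_intros simp: inner_diff_right inner_commute)
qed

text \<open>
  Up to a constant, the gap is the convex function \<open>u \<mapsto> f u + K u \<bullet> ys\<close> at \<open>x t\<close> plus the convex
  function \<open>b \<mapsto> g b - K xs \<bullet> b\<close> at \<open>y t\<close>. Pairing their gradients with \<open>x'\<close> and \<open>y'\<close> gives the
  derivative of the gap; pairing them with \<open>x - xs\<close> and \<open>y - ys\<close> dominates the gap itself; the
  anchored velocities combine the two. The extrapolated gradients of the system may replace these
  gradients because the coupling terms cancel by the definition of the adjoint.
\<close>

lemma duality_gap_decay:
  fixes f :: "'a::euclidean_space \<Rightarrow> real" and g :: "'b::euclidean_space \<Rightarrow> real"
    and K :: "'a \<Rightarrow> 'b" and xs :: 'a and ys :: 'b and A q t :: real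
  defines "L \<equiv> lagrangian f g K"
  assumes f: "convex_on UNIV f" "\<And>x. f differentiable (at x)"
    and g: "convex_on UNIV g" "\<And>y. g differentiable (at y)"
    and K: "linear K"
    and x: "(x has_vector_derivative x' t) (at t)" and y: "(y has_vector_derivative y' t) (at t)"
    and A: "A > 0" and t: "t > 0"
  defines "w \<equiv> anchored_velocity A q xs x x' t" and "v \<equiv> anchored_velocity A q ys y y' t"
  obtains D where "((\<lambda>t. L (x t) ys - L xs (y t)) has_real_derivative D) (at t)"
    and "A / t powr q * (L (x t) ys - L xs (y t)) + D
      \<le> (gradient f (x t) + adjoint K (y t + (t powr q / A) *\<^sub>R y' t)) \<bullet> w
        + (gradient g (y t) - K (x t + (t powr q / A) *\<^sub>R x' t)) \<bullet> v"
proof -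
  interpret K: linear K by fact
  interpret K': linear "adjoint K" by (rule adjoint_linear[OF K])
  have adj: "adjoint K b \<bullet> u = b \<bullet> K u" for b u
    using adjoint_works[OF K, of u b] by (simp add: inner_commute)
  define h where "h = t powr q / A"
  define a where "a = A / t powr q"
  have "a > 0" "h * a = 1" using A t by (auto simp: h_def a_def)
  define Gx where "Gx = gradient f (x t) + adjoint K ys"
  define Gy where "Gy = gradient g (y t) - K xs"
  have w: "w = a *\<^sub>R (x t - xs) + x' t" and v: "v = a *\<^sub>R (y t - ys) + y' t"
    by (simp_all add: w_def v_def anchored_velocity_def a_def)
  have shift: "x t + h *\<^sub>R x' t = xs + h *\<^sub>R w" "y t + h *\<^sub>R y' t = ys + h *\<^sub>R v"
    unfolding w v using \<open>h * a = 1\<close> by (simp_all add: scaleR_add_right)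
  have gap: "L u ys - L xs b = (f u + u \<bullet> adjoint K ys) - (f xs + xs \<bullet> adjoint K ys)
      + ((g b - K xs \<bullet> b) - (g ys - K xs \<bullet> ys))" for u b
    by (simp add: L_def lagrangian_def adjoint_works[OF K])
  define D where "D = Gx \<bullet> x' t + Gy \<bullet> y' t"
  have "((\<lambda>t. L (x t) ys - L xs (y t)) has_real_derivative D) (at t)"
  proof -
    have "GDERIV (\<lambda>u. f u + u \<bullet> adjoint K ys) (x t) :> Gx"
      using GDERIV_gradient[OF f(2)] unfolding gderiv_def Gx_def
      by (auto intro!: derivative_eq_intros simp: inner_add_right)
    note 1 = GDERIV_chain[OF this x]
    have "GDERIV (\<lambda>b. g b - K xs \<bullet> b) (y t) :> Gy"
      using GDERIV_gradient[OF g(2)] unfolding gderiv_def Gy_def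
      by (auto intro!: derivative_eq_intros simp: inner_diff_right inner_commute)
    note 2 = GDERIV_chain[OF this y]
    show ?thesis unfolding gap D_def
      by (rule DERIV_cong[OF DERIV_add[OF DERIV_diff[OF 1 DERIV_const] DERIV_diff[OF 2 DERIV_const]]])
        simp
  qed
  moreover have "a * (L (x t) ys - L xs (y t)) + D
      \<le> (gradient f (x t) + adjoint K (y t + h *\<^sub>R y' t)) \<bullet> w
        + (gradient g (y t) - K (x t + h *\<^sub>R x' t)) \<bullet> v"
  proof -
    have "L (x t) ys - L xs (y t) \<le> Gx \<bullet> (x t - xs) + Gy \<bullet> (y t - ys)"
      using convex_above_gradient[OF f(1) GDERIV_gradient[OF f(2)], of "x t" xs]
        convex_above_gradient[OF g(1) GDERIV_gradient[OF g(2)], of "y t" ys]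
      unfolding gap Gx_def Gy_def
      by (simp add: inner_add_right inner_add_left inner_diff_left inner_diff_right inner_commute)
    then have "a * (L (x t) ys - L xs (y t)) + D \<le> a * (Gx \<bullet> (x t - xs) + Gy \<bullet> (y t - ys)) + D"
      using \<open>a > 0\<close> by simp
    also have "\<dots> = Gx \<bullet> w + Gy \<bullet> v"
      by (simp add: D_def w v inner_add_right algebra_simps)
    also have "\<dots> = (gradient f (x t) + adjoint K (ys + h *\<^sub>R v)) \<bullet> w
        + (gradient g (y t) - K (xs + h *\<^sub>R w)) \<bullet> v"
      by (simp add: Gx_def Gy_def K.add K.scaleR K'.add K'.scaleR inner_add_left inner_diff_left adj
          inner_commute[of v "K w"] algebra_simps)
    finally show ?thesis unfolding shift .
  qed
  ultimately show ?thesis using that unfolding h_def a_def by blast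
qed

section \<open>Convergence of the primal-dual trajectories\<close>

theorem theorem3p2:
  fixes f :: "real ^ 'n \<Rightarrow> real" and g :: "real ^ 'm \<Rightarrow> real"
    and K :: "real ^ 'n \<Rightarrow> real ^ 'm"
    and L :: "real ^ 'n \<Rightarrow> real ^ 'm \<Rightarrow> real"
    and t0 \<alpha> q p c M :: real
    and \<beta> \<beta>' :: "real \<Rightarrow> real"
    and x x' x'' :: "real \<Rightarrow> real ^ 'n"
    and y y' y'' :: "real \<Rightarrow> real ^ 'm"
  defines "L \<equiv> lagrangian f g K"
  assumes "convex_on UNIV f" and "continuously_differentiable f"
    and "convex_on UNIV g" and "continuously_differentiable g"
    and "linear K"
    and "saddle_points L \<noteq> {}"
    and "t0 > 0" and "\<alpha> > 1" and "0 < q" and "q < 1" and "p > 0" and "c > 0"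
    and "\<And>t. t \<ge> t0 \<Longrightarrow> \<beta> t > 0"
    and "mono_on {t0..} \<beta>"
    and "\<And>t. t \<ge> t0 \<Longrightarrow> (\<beta> has_real_derivative \<beta>' t) (at t within {t0..})"
    and "continuous_on {t0..} \<beta>'"
    and "global_solution L t0 \<alpha> q p c \<beta> x x' x'' y y' y''"
    and "M > 0"
    and "\<And>t. t \<ge> t0 \<Longrightarrow> \<beta>' t / \<beta> t \<le> (\<alpha> - 1) / t powr q - M / t"
    and "(\<lambda>t. t powr (- q - p) * \<beta> t) integrable_on {t0..}"
  shows "\<forall>(xs, ys) \<in> saddle_points L.
    (\<lambda>t. L (x t) ys - L xs (y t)) \<in> o[at_top](\<lambda>t. 1 / \<beta> t) \<and>
    ((\<lambda>t. (norm (((\<alpha> - 1) / t powr q) *\<^sub>R (x t - xs) + x' t))\<^sup>2) \<longlongrightarrow> 0) at_top \<and>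
    ((\<lambda>t. (norm (((\<alpha> - 1) / t powr q) *\<^sub>R (y t - ys) + y' t))\<^sup>2) \<longlongrightarrow> 0) at_top"
proof (rule ballI, clarify, goal_cases)
  case (1 xs ys)
  define A where "A = \<alpha> - 1"
  \<comment> \<open>The third bound gives \<open>\<delta> / t \<le> t powr - q\<close> for all \<open>t \<ge> t0\<close>, because \<open>q < 1\<close>.\<close>
  define \<delta> where "\<delta> = min (min M q) (t0 powr (1 - q))"
  define C where "C = c * A / 2 * ((norm xs)\<^sup>2 + (norm ys)\<^sup>2)"
  define \<Phi> where "\<Phi> = (\<lambda>t. L (x t) ys - L xs (y t))"
  define ex where "ex = block_energy A q p c \<beta> xs x x'"
  define ey where "ey = block_energy A q p c \<beta> ys y y'"
  define E where "E = (\<lambda>t. \<beta> t * \<Phi> t + (ex t + ey t))"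
  define b where "b = (\<lambda>t. C * (t powr (- q - p) * \<beta> t))"
  have pos: "A > 0" "\<delta> > 0" "C \<ge> 0"
    using assms by (auto simp: A_def \<delta>_def C_def)
  have diff: "f differentiable (at u)" "g differentiable (at z)" for u z
    using assms(3,5) by (auto simp: continuously_differentiable_def)
  have \<Phi>: "\<Phi> t \<ge> 0" for t
  proof -
    have "L xs (y t) \<le> L xs ys" "L xs ys \<le> L (x t) ys"
      using 1 unfolding saddle_points_def by blast+
    then show ?thesis by (simp add: \<Phi>_def)
  qed
  have \<beta>: "\<beta> t > 0" if "t \<ge> t0" for t by (rule assms(14)[OF that])
  have e0: "(norm (anchored_velocity A q xs x x' t))\<^sup>2 / 2 \<le> ex t"
      "(norm (anchored_velocity A q ys y y' t))\<^sup>2 / 2 \<le> ey t" if "t \<ge> t0" for t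
    unfolding ex_def ey_def
    using block_energy_ge_half_velocity[where t = t and \<beta> = \<beta>, OF pos(1) assms(10,13) _ \<beta>[OF that]] assms(8) that
    by simp_all
  have e00: "ex t \<ge> 0" "ey t \<ge> 0" if "t \<ge> t0" for t
    using order_trans[OF _ e0(1)[OF that], of 0] order_trans[OF _ e0(2)[OF that], of 0] by auto
  have step: "\<exists>D. (E has_real_derivative D) (at t) \<and> D \<le> - (\<delta> / t) * E t + b t" if t: "t > t0" for t
  proof -
    have "t > 0" "t \<ge> t0" using t assms by auto
    have at: "at t within {t0..} = at t" using t by (intro at_within_interior) (auto simp: interior_real_atLeast)
    define w where "w = anchored_velocity A q xs x x' t"
    define v where "v = anchored_velocity A q ys y y' t"
    define Gx where "Gx = gradient f (x t) + adjoint K (y t + (t powr q / A) *\<^sub>R y' t)"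
    define Gy where "Gy = gradient g (y t) - K (x t + (t powr q / A) *\<^sub>R x' t)"
    have sol: "(x has_vector_derivative x' t) (at t)" "(x' has_vector_derivative x'' t) (at t)"
        "(y has_vector_derivative y' t) (at t)" "(y' has_vector_derivative y'' t) (at t)"
      and ode_x: "x'' t + (\<alpha> / t powr q) *\<^sub>R x' t + \<beta> t *\<^sub>R (Gx + (c / t powr p) *\<^sub>R x t) = 0"
      and ode_y: "y'' t + (\<alpha> / t powr q) *\<^sub>R y' t - \<beta> t *\<^sub>R (- Gy - (c / t powr p) *\<^sub>R y t) = 0"
      using assms(18) \<open>t \<ge> t0\<close> at unfolding global_solution_def L_def Gx_def Gy_def A_def
      by (auto simp: grad_x_lagrangian[OF assms(6) diff(1)] grad_y_lagrangian[OF diff(2)])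
    have d\<beta>: "(\<beta> has_real_derivative \<beta>' t) (at t)" using assms(16)[OF \<open>t \<ge> t0\<close>] at by simp
    have growth: "\<beta>' t \<le> (A * t powr - q - M / t) * \<beta> t"
      using assms(20)[OF \<open>t \<ge> t0\<close>] \<beta>[OF \<open>t \<ge> t0\<close>]
      by (simp add: A_def powr_minus divide_inverse pos_divide_le_eq[unfolded divide_inverse])
    have "t0 powr (1 - q) \<le> t powr (1 - q)" using assms t by (intro powr_mono2) auto
    then have "\<delta> \<le> t powr (1 - q)" unfolding \<delta>_def by simp
    then have "\<delta> / t \<le> t powr (1 - q) / t" using \<open>t > 0\<close> by (simp add: divide_right_mono)
    also have "\<dots> = t powr - q" using \<open>t > 0\<close> by (simp add: powr_diff powr_minus_divide)
    finally have \<delta>: "\<delta> > 0" "\<delta> \<le> q" "\<delta> \<le> M" "\<delta> / t \<le> t powr - q"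
      using pos by (auto simp: \<delta>_def)
    have norm_x: "x'' t + ((A + 1) * t powr - q) *\<^sub>R x' t + \<beta> t *\<^sub>R (Gx + (c * t powr - p) *\<^sub>R x t) = 0"
      using ode_x by (simp add: A_def powr_minus divide_inverse)
    have norm_y: "y'' t + ((A + 1) * t powr - q) *\<^sub>R y' t + \<beta> t *\<^sub>R (Gy + (c * t powr - p) *\<^sub>R y t) = 0"
      using ode_y by (simp add: A_def powr_minus divide_inverse algebra_simps)
    note block = block_energy_decay[OF pos(1) assms(10,12,13) \<open>t > 0\<close> \<beta>[OF \<open>t \<ge> t0\<close>] _ _ d\<beta> growth _ \<delta>]
    obtain Dx where Dx: "(ex has_real_derivative Dx) (at t)"
        "Dx \<le> - (\<delta> / t) * ex t - \<beta> t * (Gx \<bullet> w) + c * A / 2 * (norm xs)\<^sup>2 * (t powr (- q - p) * \<beta> t)"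
      using block[OF sol(1,2) norm_x] unfolding ex_def w_def by metis
    obtain Dy where Dy: "(ey has_real_derivative Dy) (at t)"
        "Dy \<le> - (\<delta> / t) * ey t - \<beta> t * (Gy \<bullet> v) + c * A / 2 * (norm ys)\<^sup>2 * (t powr (- q - p) * \<beta> t)"
      using block[OF sol(3,4) norm_y] unfolding ey_def v_def by metis
    obtain D where D: "(\<Phi> has_real_derivative D) (at t)"
        "A / t powr q * \<Phi> t + D \<le> Gx \<bullet> w + Gy \<bullet> v"
      using duality_gap_decay[where x = x and x' = x' and y = y and y' = y' and t = t
          and xs = xs and ys = ys and q = q,
          OF assms(2) diff(1) assms(4) diff(2) assms(6) sol(1,3) pos(1) \<open>t > 0\<close>]
      unfolding \<Phi>_def L_def Gx_def Gy_def w_def v_def by blast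
    have "(E has_real_derivative (\<beta> t * D + \<beta>' t * \<Phi> t + (Dx + Dy))) (at t)"
      unfolding E_def by (auto intro!: derivative_eq_intros Dx Dy D d\<beta>)
    moreover have "\<beta> t * D + \<beta>' t * \<Phi> t + (Dx + Dy) \<le> - (\<delta> / t) * E t + b t"
    proof -
      \<comment> \<open>The term \<open>A t^-q \<beta> \<Phi>\<close> allowed by the growth of \<open>\<beta>\<close> is the one gained from convexity.\<close>
      have "\<beta>' t * \<Phi> t \<le> (A * t powr - q - M / t) * \<beta> t * \<Phi> t"
        using growth \<Phi> by (intro mult_right_mono) auto
      also have "\<dots> = A * t powr - q * (\<beta> t * \<Phi> t) - M * (\<beta> t * \<Phi> t / t)"
        by (simp add: left_diff_distrib)
      finally have 1: "\<beta>' t * \<Phi> t \<le> A * t powr - q * (\<beta> t * \<Phi> t) - M * (\<beta> t * \<Phi> t / t)" .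
      have "\<beta> t * (A / t powr q * \<Phi> t + D) \<le> \<beta> t * (Gx \<bullet> w + Gy \<bullet> v)"
        using D(2) \<beta>[OF \<open>t \<ge> t0\<close>] by (intro mult_left_mono) auto
      moreover have "\<beta> t * (A / t powr q * \<Phi> t + D) = A * t powr - q * (\<beta> t * \<Phi> t) + \<beta> t * D"
        by (simp add: powr_minus divide_inverse distrib_left)
      ultimately have 2: "A * t powr - q * (\<beta> t * \<Phi> t) + \<beta> t * D \<le> \<beta> t * (Gx \<bullet> w) + \<beta> t * (Gy \<bullet> v)"
        by (simp add: distrib_left)
      have 3: "\<delta> * (\<beta> t * \<Phi> t / t) \<le> M * (\<beta> t * \<Phi> t / t)"
        using \<delta>(3) \<Phi> \<beta>[OF \<open>t \<ge> t0\<close>] \<open>t > 0\<close> by (intro mult_right_mono) auto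
      have 4: "- (\<delta> / t) * E t = - \<delta> * (\<beta> t * \<Phi> t / t) + - (\<delta> / t) * ex t + - (\<delta> / t) * ey t"
        by (simp add: E_def distrib_left)
      have "b t = c * A / 2 * (norm xs)\<^sup>2 * (t powr (- q - p) * \<beta> t)
          + c * A / 2 * (norm ys)\<^sup>2 * (t powr (- q - p) * \<beta> t)"
        unfolding b_def C_def by (simp add: algebra_simps)
      with 1 2 3 4 Dx(2) Dy(2) show ?thesis by linarith
    qed
    ultimately show ?thesis by blast
  qed
  then obtain E' where E': "\<And>t. t > t0 \<Longrightarrow> (E has_real_derivative E' t) (at t)"
      "\<And>t. t > t0 \<Longrightarrow> E' t \<le> - (\<delta> / t) * E t + b t" by metis
  have "continuous_on {t0..} \<beta>"
    using assms(16) by (intro DERIV_continuous_on) auto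
  then have "continuous_on {t0..} b"
    unfolding b_def using assms(8) by (intro continuous_intros) auto
  moreover have "b integrable_on {t0..}"
    unfolding b_def using integrable_cmul[OF assms(21), of C] by simp
  ultimately have E_lim: "(E \<longlongrightarrow> 0) at_top"
    using pos \<Phi> \<beta> e00 E' assms(8)
    by (intro damped_tendsto_zero[of t0 \<delta> E E' b]) (auto simp: E_def b_def less_imp_le)
  have parts: "eventually (\<lambda>t. \<beta> t > 0 \<and> \<bar>\<beta> t * \<Phi> t\<bar> \<le> E t
      \<and> (norm (anchored_velocity A q xs x x' t))\<^sup>2 \<le> 2 * E t
      \<and> (norm (anchored_velocity A q ys y y' t))\<^sup>2 \<le> 2 * E t) at_top"
    using eventually_ge_at_top[of t0]
  proof eventually_elim
    case (elim t)
    have "\<beta> t * \<Phi> t \<ge> 0" using \<Phi>[of t] \<beta>[OF elim] by simp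
    then show ?case using e0[OF elim] e00[OF elim] \<beta>[OF elim] unfolding E_def by auto
  qed
  have E2: "((\<lambda>t. 2 * E t) \<longlongrightarrow> 0) at_top" using tendsto_mult_right_zero[OF E_lim] .
  have "((\<lambda>t. \<beta> t * \<Phi> t) \<longlongrightarrow> 0) at_top"
    by (rule Lim_null_comparison[OF _ E_lim]) (use parts in \<open>auto elim: eventually_mono\<close>)
  then have "\<Phi> \<in> o[at_top](\<lambda>t. 1 / \<beta> t)"
    using parts by (intro smalloI_tendsto) (auto elim: eventually_mono simp: mult.commute)
  moreover have "((\<lambda>t. (norm (anchored_velocity A q xs x x' t))\<^sup>2) \<longlongrightarrow> 0) at_top"
    by (rule Lim_null_comparison[OF _ E2]) (use parts in \<open>auto elim: eventually_mono\<close>)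
  moreover have "((\<lambda>t. (norm (anchored_velocity A q ys y y' t))\<^sup>2) \<longlongrightarrow> 0) at_top"
    by (rule Lim_null_comparison[OF _ E2]) (use parts in \<open>auto elim: eventually_mono\<close>)
  ultimately show ?case
    unfolding \<Phi>_def anchored_velocity_def A_def by blast
qed

end
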